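(* Let $Ax$ be a set formed by one or more of the axiom schemas (ciw), (ci), (cl), (cf), (ce), and let $\Gamma\cup\{\varphi\}\subseteq For(\Sigma)$. Then $\Gamma\vdash_{\mathbf{RmbC}(Ax)}\varphi$ if and only if $\Gamma\models_{\mathbb{NM}(Ax)}\varphi$.
   Context: Let $\Sigma=\{\wedge,\vee,\to,\neg,\circ\}$ ($\neg,\circ$ unary, the others binary) and let $For(\Sigma)$ be the set of formulas over $\Sigma$ generated by a denumerable set $\mathcal V$ of propositional variables. $\alpha\leftrightarrow\beta$ abbreviates $(\alpha\to\beta)\wedge(\beta\to\alpha)$. $\mathbf{RmbC}$ is the Hilbert calculus with axiom schemas: (Ax1) $\alpha\to(\beta\to\alpha)$; (Ax2) $(\alpha\to(\beta\to\gamma))\to((\alpha\to\beta)\to(\alpha\to\gamma))$; (Ax3) $\alpha\to(\beta\to(\alpha\wedge\beta))$; (Ax4) $(\alpha\wedge\beta)\to\alpha$; (Ax5) $(\alpha\wedge\beta)\to\beta$; (Ax6) $\alpha\to(\alpha\vee\beta)$; (Ax7) $\beta\to(\alpha\vee\beta)$; (Ax8) $(\alpha\to\gamma)\to((\beta\to\gamma)\to((\alpha\vee\beta)\to\gamma))$; (Ax9) $(\alpha\to\beta)\vee\alpha$; (Ax10) $\alpha\vee\neg\alpha$; (bc1) $\circ\alpha\to(\alpha\to(\neg\alpha\to\beta))$; and rules: (MP) from $\alpha$ and $\alpha\to\beta$ infer $\beta$; $(\mathbf R_\neg)$ from $\alpha\leftrightarrow\beta$ infer $\neg\alpha\leftrightarrow\neg\beta$;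 $(\mathbf R_\circ)$ from $\alpha\leftrightarrow\beta$ infer $\circ\alpha\leftrightarrow\circ\beta$. Additional schemas: (ciw) $\circ\alpha\vee(\alpha\wedge\neg\alpha)$; (ci) $\neg\circ\alpha\to(\alpha\wedge\neg\alpha)$; (cl) $\neg(\alpha\wedge\neg\alpha)\to\circ\alpha$; (cf) $\neg\neg\alpha\to\alpha$; (ce) $\alpha\to\neg\neg\alpha$. $\mathbf{RmbC}(Ax)$ is $\mathbf{RmbC}$ plus the schemas in $Ax$. In it, $\varphi$ is a theorem ($\vdash\varphi$) if there is a finite sequence of formulas ending in $\varphi$ each of which is an instance of an axiom schema or follows from earlier formulas of the sequence by a rule; $\Gamma\vdash\varphi$ means that either $\vdash\varphi$ or there is a finite non-empty $\{\gamma_1,\dots,\gamma_n\}\subseteq\Gamma$ with $\vdash(\gamma_1\wedge(\gamma_2\wedge(\cdots\wedge(\gamma_{n-1}\wedge\gamma_n)\cdots)))\to\varphi$. A neighborhood frame for $\mathbf{RmbC}$ is $\mathcal F=\langle W,S_\neg,S_\circ\rangle$ with $W$ a non-empty set and $S_\neg,S_\circ:\wp(W)\to\wp(W)$ functions. A neighborhood model over $\mathcal F$ is $\mathcal M=\langle\mathcal F,d\rangle$ with $d:\mathcal V\to\wp(W)$. The denotation $[\![\cdot]\!]_{\mathcal M}:For(\Sigma)\to\wp(W)$ is: $[\![p]\!]=d(p)$; $[\![\varphi\wedge\psi]\!]=[\![\varphi]\!]\cap[\![\psi]\!]$; $[\![\varphi\vee\psi]\!]=[\![\varphi]\!]\cup[\![\psi]\!]$;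 $[\![\varphi\to\psi]\!]=(W\setminus[\![\varphi]\!])\cup[\![\psi]\!]$; $[\![\neg\varphi]\!]=(W\setminus[\![\varphi]\!])\cup S_\neg([\![\varphi]\!])$; $[\![\circ\varphi]\!]=(W\setminus([\![\varphi]\!]\cap S_\neg([\![\varphi]\!])))\cap S_\circ([\![\varphi]\!])$. A formula (or schema, meaning all its instances) is valid in $\mathcal F$ if $[\![\cdot]\!]_{\mathcal M}$ maps it to $W$ for every model $\mathcal M$ over $\mathcal F$. $\mathbb{NM}(Ax)$ is the class of neighborhood frames in which every schema in $Ax$ is valid. $\models_{\mathbb{NM}(Ax)}\varphi$ means $\varphi$ is valid in every frame in $\mathbb{NM}(Ax)$; $\Gamma\models_{\mathbb{NM}(Ax)}\varphi$ means that either $\models_{\mathbb{NM}(Ax)}\varphi$ or there is a finite non-empty $\{\gamma_1,\dots,\gamma_n\}\subseteq\Gamma$ with $\models_{\mathbb{NM}(Ax)}(\gamma_1\wedge\cdots\wedge\gamma_n)\to\varphi$. *)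

theory Defs
  imports "HOL-Library.FuncSet"
begin

datatype fm =
    Var nat
  | Con fm fm (infixr "\<^bold>\<and>" 70)
  | Dis fm fm (infixr "\<^bold>\<or>" 65)
  | Imp fm fm (infixr "\<^bold>\<rightarrow>" 60)
  | Neg fm ("\<^bold>\<not> _" [80] 80)
  | Circ fm ("\<^bold>\<circ> _" [80] 80)

abbreviation Iff :: "fm \<Rightarrow> fm \<Rightarrow> fm" (infix "\<^bold>\<leftrightarrow>" 55) where
  "\<alpha> \<^bold>\<leftrightarrow> \<beta> \<equiv> (\<alpha> \<^bold>\<rightarrow> \<beta>) \<^bold>\<and> (\<beta> \<^bold>\<rightarrow> \<alpha>)"

inductive RmbC_axiom :: "fm \<Rightarrow> bool" where
  Ax1: "RmbC_axiom (\<alpha> \<^bold>\<rightarrow> (\<beta> \<^bold>\<rightarrow> \<alpha>))"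
| Ax2: "RmbC_axiom ((\<alpha> \<^bold>\<rightarrow> (\<beta> \<^bold>\<rightarrow> \<gamma>)) \<^bold>\<rightarrow> ((\<alpha> \<^bold>\<rightarrow> \<beta>) \<^bold>\<rightarrow> (\<alpha> \<^bold>\<rightarrow> \<gamma>)))"
| Ax3: "RmbC_axiom (\<alpha> \<^bold>\<rightarrow> (\<beta> \<^bold>\<rightarrow> (\<alpha> \<^bold>\<and> \<beta>)))"
| Ax4: "RmbC_axiom ((\<alpha> \<^bold>\<and> \<beta>) \<^bold>\<rightarrow> \<alpha>)"
| Ax5: "RmbC_axiom ((\<alpha> \<^bold>\<and> \<beta>) \<^bold>\<rightarrow> \<beta>)"
| Ax6: "RmbC_axiom (\<alpha> \<^bold>\<rightarrow> (\<alpha> \<^bold>\<or> \<beta>))"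
| Ax7: "RmbC_axiom (\<beta> \<^bold>\<rightarrow> (\<alpha> \<^bold>\<or> \<beta>))"
| Ax8: "RmbC_axiom ((\<alpha> \<^bold>\<rightarrow> \<gamma>) \<^bold>\<rightarrow> ((\<beta> \<^bold>\<rightarrow> \<gamma>) \<^bold>\<rightarrow> ((\<alpha> \<^bold>\<or> \<beta>) \<^bold>\<rightarrow> \<gamma>)))"
| Ax9: "RmbC_axiom ((\<alpha> \<^bold>\<rightarrow> \<beta>) \<^bold>\<or> \<alpha>)"
| Ax10: "RmbC_axiom (\<alpha> \<^bold>\<or> \<^bold>\<not> \<alpha>)"
| bc1: "RmbC_axiom (\<^bold>\<circ> \<alpha> \<^bold>\<rightarrow> (\<alpha> \<^bold>\<rightarrow> (\<^bold>\<not> \<alpha> \<^bold>\<rightarrow> \<beta>)))"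

datatype schema = Ciw | Ci | Cl | Cf | Ce

fun inst :: "schema \<Rightarrow> fm \<Rightarrow> fm" where
  "inst Ciw \<alpha> = (\<^bold>\<circ> \<alpha> \<^bold>\<or> (\<alpha> \<^bold>\<and> \<^bold>\<not> \<alpha>))"
| "inst Ci \<alpha> = (\<^bold>\<not> \<^bold>\<circ> \<alpha> \<^bold>\<rightarrow> (\<alpha> \<^bold>\<and> \<^bold>\<not> \<alpha>))"
| "inst Cl \<alpha> = (\<^bold>\<not> (\<alpha> \<^bold>\<and> \<^bold>\<not> \<alpha>) \<^bold>\<rightarrow> \<^bold>\<circ> \<alpha>)"
| "inst Cf \<alpha> = (\<^bold>\<not> \<^bold>\<not> \<alpha> \<^bold>\<rightarrow> \<alpha>)"
| "inst Ce \<alpha> = (\<alpha> \<^bold>\<rightarrow> \<^bold>\<not> \<^bold>\<not> \<alpha>)"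

inductive follows_by_rule :: "fm set \<Rightarrow> fm \<Rightarrow> bool" for \<Phi> where
  MP: "\<lbrakk>\<alpha> \<in> \<Phi>; (\<alpha> \<^bold>\<rightarrow> \<beta>) \<in> \<Phi>\<rbrakk> \<Longrightarrow> follows_by_rule \<Phi> \<beta>"
| R_neg: "(\<alpha> \<^bold>\<leftrightarrow> \<beta>) \<in> \<Phi> \<Longrightarrow> follows_by_rule \<Phi> (\<^bold>\<not> \<alpha> \<^bold>\<leftrightarrow> \<^bold>\<not> \<beta>)"
| R_circ: "(\<alpha> \<^bold>\<leftrightarrow> \<beta>) \<in> \<Phi> \<Longrightarrow> follows_by_rule \<Phi> (\<^bold>\<circ> \<alpha> \<^bold>\<leftrightarrow> \<^bold>\<circ> \<beta>)"

definition derivation :: "schema set \<Rightarrow> fm list \<Rightarrow> bool" where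
  "derivation Ax \<phi>s \<longleftrightarrow>
     (\<forall>i < length \<phi>s. RmbC_axiom (\<phi>s ! i) \<or> (\<exists>s \<in> Ax. \<exists>\<alpha>. \<phi>s ! i = inst s \<alpha>)
        \<or> follows_by_rule (set (take i \<phi>s)) (\<phi>s ! i))"

definition provable :: "schema set \<Rightarrow> fm \<Rightarrow> bool" where
  "provable Ax \<phi> \<longleftrightarrow> (\<exists>\<phi>s. \<phi>s \<noteq> [] \<and> last \<phi>s = \<phi> \<and> derivation Ax \<phi>s)"

(* Right-nested conjunction of a non-empty list; deliberately unspecified on []. *)
fun conjs :: "fm list \<Rightarrow> fm" where
  "conjs [\<gamma>] = \<gamma>"
| "conjs (\<gamma> # \<delta> # \<gamma>s) = (\<gamma> \<^bold>\<and> conjs (\<delta> # \<gamma>s))"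

definition derivable :: "schema set \<Rightarrow> fm set \<Rightarrow> fm \<Rightarrow> bool" where
  "derivable Ax \<Gamma> \<phi> \<longleftrightarrow> provable Ax \<phi> \<or>
     (\<exists>\<gamma>s. \<gamma>s \<noteq> [] \<and> set \<gamma>s \<subseteq> \<Gamma> \<and> provable Ax (conjs \<gamma>s \<^bold>\<rightarrow> \<phi>))"

(* The set of worlds is an arbitrary non-empty subset of the type 'w. The values of
   Sneg and Scirc outside Pow (worlds F) are irrelevant. *)
record 'w frame =
  worlds :: "'w set"
  Sneg :: "'w set \<Rightarrow> 'w set"
  Scirc :: "'w set \<Rightarrow> 'w set"

definition is_frame :: "'w frame \<Rightarrow> bool" where
  "is_frame F \<longleftrightarrow> worlds F \<noteq> {} \<and>
     Sneg F \<in> Pow (worlds F) \<rightarrow> Pow (worlds F) \<and>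
     Scirc F \<in> Pow (worlds F) \<rightarrow> Pow (worlds F)"

primrec denot :: "'w frame \<Rightarrow> (nat \<Rightarrow> 'w set) \<Rightarrow> fm \<Rightarrow> 'w set" where
  "denot F d (Var p) = d p"
| "denot F d (\<phi> \<^bold>\<and> \<psi>) = denot F d \<phi> \<inter> denot F d \<psi>"
| "denot F d (\<phi> \<^bold>\<or> \<psi>) = denot F d \<phi> \<union> denot F d \<psi>"
| "denot F d (\<phi> \<^bold>\<rightarrow> \<psi>) = (worlds F - denot F d \<phi>) \<union> denot F d \<psi>"
| "denot F d (\<^bold>\<not> \<phi>) = (worlds F - denot F d \<phi>) \<union> Sneg F (denot F d \<phi>)"
| "denot F d (\<^bold>\<circ> \<phi>) =
     (worlds F - (denot F d \<phi> \<inter> Sneg F (denot F d \<phi>))) \<inter> Scirc F (denot F d \<phi>)"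

definition valid_in :: "'w frame \<Rightarrow> fm \<Rightarrow> bool" where
  "valid_in F \<phi> \<longleftrightarrow> (\<forall>d \<in> UNIV \<rightarrow> Pow (worlds F). denot F d \<phi> = worlds F)"

definition NM :: "schema set \<Rightarrow> 'w frame set" where
  "NM Ax = {F. is_frame F \<and> (\<forall>s \<in> Ax. \<forall>\<alpha>. valid_in F (inst s \<alpha>))}"

(* HOL cannot quantify over types inside a formula, so semantic consequence is relative
   to the type 'w that the worlds are drawn from. Consequence over all frames is its
   conjunction over all types 'w. The type fm set is large enough for the canonical
   frame, whose worlds are sets of formulas; over a small type completeness fails. *)
definition NM_valid :: "'w itself \<Rightarrow> schema set \<Rightarrow> fm \<Rightarrow> bool" where
  "NM_valid T Ax \<phi> \<longleftrightarrow> (\<forall>F \<in> (NM Ax :: 'w frame set). valid_in F \<phi>)"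

definition NM_consequence :: "'w itself \<Rightarrow> schema set \<Rightarrow> fm set \<Rightarrow> fm \<Rightarrow> bool" where
  "NM_consequence T Ax \<Gamma> \<phi> \<longleftrightarrow> NM_valid T Ax \<phi> \<or>
     (\<exists>\<gamma>s. \<gamma>s \<noteq> [] \<and> set \<gamma>s \<subseteq> \<Gamma> \<and> NM_valid T Ax (conjs \<gamma>s \<^bold>\<rightarrow> \<phi>))"

end

(* Soundness is a direct check. For completeness, take as worlds the prime proper theories.
   Denotations of formulas form a Boolean algebra of "definable" sets on which the rules
   R_neg and R_circ make the neighborhood functions well defined. The schemas must be valid in the
   frame, i.e. under all valuations, so the functions have to be chosen well on the
   non-definable sets too: there negation is classical complement and every such set is
   consistent. As non-definable sets are closed under complement, cf and ce survive, and
   ciw and cl are immediate; ci additionally needs that the negation of a theorem is empty,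
   which holds because ci proves that consistency assertions are themselves consistent. *)
theory Submission
  imports Defs
begin

section \<open>Provability\<close>

lemma follows_by_rule_mono: "follows_by_rule A \<phi> \<Longrightarrow> A \<subseteq> B \<Longrightarrow> follows_by_rule B \<phi>"
  by (induction rule: follows_by_rule.induct) (auto intro: follows_by_rule.intros)

lemma derivation_Nil [simp]: "derivation Ax []"
  by (simp add: derivation_def)

text \<open>Recasts the indexed definition as a recursion on the last formula, which is the form
  needed for induction with \<open>rev_induct\<close> and for appending a rule application.\<close>

lemma derivation_snoc:
  "derivation Ax (xs @ [\<phi>]) \<longleftrightarrow> derivation Ax xs \<and>
     (RmbC_axiom \<phi> \<or> (\<exists>s\<in>Ax. \<exists>\<alpha>. \<phi> = inst s \<alpha>) \<or> follows_by_rule (set xs) \<phi>)"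
  unfolding derivation_def by (auto simp: nth_append less_Suc_eq)

lemma derivation_append: "derivation Ax xs \<Longrightarrow> derivation Ax ys \<Longrightarrow> derivation Ax (xs @ ys)"
proof (induction ys rule: rev_induct)
  case (snoc y ys)
  then show ?case
    unfolding append_assoc [symmetric] derivation_snoc
    by (auto intro: follows_by_rule_mono [OF _ Un_upper2])
qed simp

lemma provable_iff: "provable Ax \<phi> \<longleftrightarrow> (\<exists>xs. derivation Ax (xs @ [\<phi>]))"
  unfolding provable_def by (metis append_butlast_last_id append_is_Nil_conv last_snoc not_Cons_self)

lemma provable_axiom: "RmbC_axiom \<phi> \<Longrightarrow> provable Ax \<phi>"
  and provable_inst: "s \<in> Ax \<Longrightarrow> provable Ax (inst s \<alpha>)"
  unfolding provable_iff derivation_snoc by (auto intro!: exI [of _ "[]"])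

lemma provable_MP:
  assumes "provable Ax \<alpha>" and "provable Ax (\<alpha> \<^bold>\<rightarrow> \<beta>)"
  shows "provable Ax \<beta>"
proof -
  obtain xs ys where "derivation Ax (xs @ [\<alpha>])" and "derivation Ax (ys @ [\<alpha> \<^bold>\<rightarrow> \<beta>])"
    using assms unfolding provable_iff by blast
  then have "derivation Ax ((xs @ [\<alpha>]) @ (ys @ [\<alpha> \<^bold>\<rightarrow> \<beta>]))"
    by (rule derivation_append)
  then have "derivation Ax (((xs @ [\<alpha>]) @ (ys @ [\<alpha> \<^bold>\<rightarrow> \<beta>])) @ [\<beta>])"
    unfolding derivation_snoc [of _ _ \<beta>] by (auto intro: MP)
  then show ?thesis
    unfolding provable_iff by blast
qed

lemma provable_R_neg: "provable Ax (\<alpha> \<^bold>\<leftrightarrow> \<beta>) \<Longrightarrow> provable Ax (\<^bold>\<not> \<alpha> \<^bold>\<leftrightarrow> \<^bold>\<not> \<beta>)"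
  and provable_R_circ: "provable Ax (\<alpha> \<^bold>\<leftrightarrow> \<beta>) \<Longrightarrow> provable Ax (\<^bold>\<circ> \<alpha> \<^bold>\<leftrightarrow> \<^bold>\<circ> \<beta>)"
proof -
  assume "provable Ax (\<alpha> \<^bold>\<leftrightarrow> \<beta>)"
  then obtain xs where xs: "derivation Ax (xs @ [\<alpha> \<^bold>\<leftrightarrow> \<beta>])"
    unfolding provable_iff by blast
  have "derivation Ax ((xs @ [\<alpha> \<^bold>\<leftrightarrow> \<beta>]) @ [\<^bold>\<not> \<alpha> \<^bold>\<leftrightarrow> \<^bold>\<not> \<beta>])"
    using xs unfolding derivation_snoc [of _ "xs @ _"] by (auto intro: R_neg)
  then show "provable Ax (\<^bold>\<not> \<alpha> \<^bold>\<leftrightarrow> \<^bold>\<not> \<beta>)"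
    unfolding provable_iff by blast
  have "derivation Ax ((xs @ [\<alpha> \<^bold>\<leftrightarrow> \<beta>]) @ [\<^bold>\<circ> \<alpha> \<^bold>\<leftrightarrow> \<^bold>\<circ> \<beta>])"
    using xs unfolding derivation_snoc [of _ "xs @ _"] by (auto intro: R_circ)
  then show "provable Ax (\<^bold>\<circ> \<alpha> \<^bold>\<leftrightarrow> \<^bold>\<circ> \<beta>)"
    unfolding provable_iff by blast
qed

section \<open>Soundness\<close>

lemma denot_subset:
  assumes "is_frame F" and "d \<in> UNIV \<rightarrow> Pow (worlds F)"
  shows "denot F d \<phi> \<subseteq> worlds F"
  using assms by (induction \<phi>) (auto simp: is_frame_def Pi_iff)

lemma valid_in_axiom:
  assumes "is_frame F" and "RmbC_axiom \<phi>"
  shows "valid_in F \<phi>"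
  unfolding valid_in_def
proof
  fix d :: "nat \<Rightarrow> _" assume d: "d \<in> UNIV \<rightarrow> Pow (worlds F)"
  note sub = denot_subset [OF assms(1) d]
  have "denot F d \<phi> \<supseteq> worlds F"
    using assms(2) by cases auto
  with sub show "denot F d \<phi> = worlds F"
    by blast
qed

lemma valid_in_rule:
  assumes "is_frame F" and "follows_by_rule \<Phi> \<phi>" and "\<And>\<psi>. \<psi> \<in> \<Phi> \<Longrightarrow> valid_in F \<psi>"
  shows "valid_in F \<phi>"
  unfolding valid_in_def
proof
  fix d :: "nat \<Rightarrow> _" assume d: "d \<in> UNIV \<rightarrow> Pow (worlds F)"
  note sub = denot_subset [OF assms(1) d]
  have val: "denot F d \<psi> = worlds F" if "\<psi> \<in> \<Phi>" for \<psi>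
    using assms(3) that d by (auto simp: valid_in_def)
  have eq: "denot F d \<alpha> = denot F d \<beta>" if "(\<alpha> \<^bold>\<leftrightarrow> \<beta>) \<in> \<Phi>" for \<alpha> \<beta>
    using val [OF that] sub [of \<alpha>] sub [of \<beta>] by auto
  show "denot F d \<phi> = worlds F"
    using assms(2)
  proof cases
    case (MP \<alpha>)
    then show ?thesis
      using val [of \<alpha>] val [of "\<alpha> \<^bold>\<rightarrow> \<phi>"] sub [of \<phi>] by auto
  next
    case (R_neg \<alpha> \<beta>)
    then show ?thesis
      using eq [of \<alpha> \<beta>] sub [of "\<^bold>\<not> \<beta>"] by auto
  next
    case (R_circ \<alpha> \<beta>)
    then show ?thesis
      using eq [of \<alpha> \<beta>] sub [of "\<^bold>\<circ> \<beta>"] by auto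
  qed
qed

lemma derivation_sound:
  assumes "F \<in> NM Ax" and "derivation Ax \<phi>s" and "\<phi> \<in> set \<phi>s"
  shows "valid_in F \<phi>"
  using assms(2,3)
proof (induction \<phi>s arbitrary: \<phi> rule: rev_induct)
  case (snoc \<psi> \<phi>s)
  then have "valid_in F \<psi>"
    using assms(1) valid_in_axiom valid_in_rule
    unfolding derivation_snoc NM_def by blast
  with snoc show ?case
    by (auto simp: derivation_snoc)
qed simp

lemma soundness: "provable Ax \<phi> \<Longrightarrow> NM_valid T Ax \<phi>"
  unfolding NM_valid_def provable_def using derivation_sound last_in_set by blast

section \<open>Prime theories\<close>

text \<open>Closure is under modus ponens alone: \<open>R_neg\<close> and \<open>R_circ\<close>
  apply to theorems, not to assumptions, so a theory need not respect them.\<close>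

locale RmbC_theory =
  fixes Ax :: "schema set" and T :: "fm set"
  assumes provable_mem: "provable Ax \<phi> \<Longrightarrow> \<phi> \<in> T"
    and mp: "\<alpha> \<^bold>\<rightarrow> \<beta> \<in> T \<Longrightarrow> \<alpha> \<in> T \<Longrightarrow> \<beta> \<in> T"
begin

lemma axiom: "RmbC_axiom \<phi> \<Longrightarrow> \<phi> \<in> T"
  by (intro provable_mem provable_axiom)

lemma Con_iff: "\<alpha> \<^bold>\<and> \<beta> \<in> T \<longleftrightarrow> \<alpha> \<in> T \<and> \<beta> \<in> T"
  by (meson axiom mp Ax3 Ax4 Ax5)

text \<open>The deduction theorem in semantic guise: this set is the least theory containing
  \<open>T\<close> and \<open>\<alpha>\<close>. Ax1 and Ax2 give closure.\<close>

lemma Imp_theory: "RmbC_theory Ax {\<chi>. \<alpha> \<^bold>\<rightarrow> \<chi> \<in> T}"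
proof
  show "\<phi> \<in> {\<chi>. \<alpha> \<^bold>\<rightarrow> \<chi> \<in> T}" if "provable Ax \<phi>" for \<phi>
    using that axiom [OF Ax1] mp provable_mem by blast
  show "\<gamma> \<in> {\<chi>. \<alpha> \<^bold>\<rightarrow> \<chi> \<in> T}"
    if "\<beta> \<^bold>\<rightarrow> \<gamma> \<in> {\<chi>. \<alpha> \<^bold>\<rightarrow> \<chi> \<in> T}" "\<beta> \<in> {\<chi>. \<alpha> \<^bold>\<rightarrow> \<chi> \<in> T}" for \<beta> \<gamma>
    using that axiom [OF Ax2] mp by blast
qed

lemma Imp_superset: "T \<subseteq> {\<chi>. \<alpha> \<^bold>\<rightarrow> \<chi> \<in> T}"
  using axiom [OF Ax1] mp by blast

lemma Imp_refl: "\<alpha> \<^bold>\<rightarrow> \<alpha> \<in> T"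
  using axiom [OF Ax1 [of \<alpha> \<alpha>]] axiom [OF Ax1 [of \<alpha> "\<alpha> \<^bold>\<rightarrow> \<alpha>"]]
    axiom [OF Ax2 [of \<alpha> "\<alpha> \<^bold>\<rightarrow> \<alpha>" \<alpha>]] mp by blast

end

locale prime_theory = RmbC_theory +
  assumes proper: "T \<noteq> UNIV"
    and prime: "\<alpha> \<^bold>\<or> \<beta> \<in> T \<Longrightarrow> \<alpha> \<in> T \<or> \<beta> \<in> T"
begin

lemma Dis_iff: "\<alpha> \<^bold>\<or> \<beta> \<in> T \<longleftrightarrow> \<alpha> \<in> T \<or> \<beta> \<in> T"
  by (meson axiom mp prime Ax6 Ax7)

lemma Imp_iff: "\<alpha> \<^bold>\<rightarrow> \<beta> \<in> T \<longleftrightarrow> (\<alpha> \<in> T \<longrightarrow> \<beta> \<in> T)"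
  by (meson axiom mp prime Ax1 Ax9)

lemma Neg_intro: "\<alpha> \<notin> T \<Longrightarrow> \<^bold>\<not> \<alpha> \<in> T"
  by (meson axiom prime Ax10)

lemma Circ_explosion: "\<^bold>\<circ> \<alpha> \<in> T \<Longrightarrow> \<alpha> \<in> T \<Longrightarrow> \<^bold>\<not> \<alpha> \<in> T \<Longrightarrow> False"
  using axiom [OF bc1] mp proper by blast

end

text \<open>Lindenbaum's lemma: Zorn yields a theory maximal among those that extend
  \<open>T\<close> and omit \<open>\<psi>\<close>, and maximality makes it prime.\<close>

lemma prime_extension:
  assumes "RmbC_theory Ax T" and "\<psi> \<notin> T"
  obtains w where "prime_theory Ax w" and "T \<subseteq> w" and "\<psi> \<notin> w"
proof -
  define \<A> where "\<A> = {U. RmbC_theory Ax U \<and> T \<subseteq> U \<and> \<psi> \<notin> U}"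
  have "\<A> \<noteq> {}"
    using assms by (auto simp: \<A>_def)
  moreover have "\<Union>\<C> \<in> \<A>" if "\<C> \<noteq> {}" and chain: "subset.chain \<A> \<C>" for \<C>
  proof -
    have sub: "\<C> \<subseteq> \<A>"
      using chain by (simp add: subset.chain_def)
    have "RmbC_theory Ax (\<Union>\<C>)"
    proof
      show "\<phi> \<in> \<Union>\<C>" if "provable Ax \<phi>" for \<phi>
        using \<open>\<C> \<noteq> {}\<close> sub that RmbC_theory.provable_mem by (fastforce simp: \<A>_def)
      show "\<beta> \<in> \<Union>\<C>" if prems: "\<alpha> \<^bold>\<rightarrow> \<beta> \<in> \<Union>\<C>" "\<alpha> \<in> \<Union>\<C>" for \<alpha> \<beta>
      proof -
        obtain U V where "U \<in> \<C>" "\<alpha> \<^bold>\<rightarrow> \<beta> \<in> U" "V \<in> \<C>" "\<alpha> \<in> V"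
          using prems by blast
        then obtain X where "X \<in> \<C>" "\<alpha> \<^bold>\<rightarrow> \<beta> \<in> X" "\<alpha> \<in> X"
          using chain unfolding subset_chain_def by blast
        then show ?thesis
          using sub RmbC_theory.mp by (fastforce simp: \<A>_def)
      qed
    qed
    with \<open>\<C> \<noteq> {}\<close> sub show ?thesis
      by (auto simp: \<A>_def)
  qed
  ultimately obtain w where w: "w \<in> \<A>" and max: "\<And>X. X \<in> \<A> \<Longrightarrow> w \<subseteq> X \<Longrightarrow> X = w"
    using subset_Zorn_nonempty [of \<A>] by blast
  from w interpret RmbC_theory Ax w
    by (simp add: \<A>_def)
  have \<psi>: "\<psi> \<notin> w" and T: "T \<subseteq> w"
    using w by (auto simp: \<A>_def)
  have imp: "\<alpha> \<^bold>\<rightarrow> \<psi> \<in> w" if "\<alpha> \<notin> w" for \<alpha>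
  proof (rule ccontr)
    assume "\<alpha> \<^bold>\<rightarrow> \<psi> \<notin> w"
    \<comment> \<open>Adjoining \<open>\<alpha>\<close> to \<open>w\<close> would still omit
      \<open>\<psi>\<close>, so by maximality \<open>\<alpha>\<close> would already lie in
      \<open>w\<close>.\<close>
    then have "{\<chi>. \<alpha> \<^bold>\<rightarrow> \<chi> \<in> w} \<in> \<A>"
      using T Imp_theory [of \<alpha>] Imp_superset [of \<alpha>] by (auto simp: \<A>_def)
    from max [OF this Imp_superset] show False
      using that Imp_refl [of \<alpha>] by blast
  qed
  have "prime_theory Ax w"
  proof
    show "w \<noteq> UNIV"
      using \<psi> by blast
    \<comment> \<open>If both disjuncts were missing, each would imply \<open>\<psi>\<close> in
      \<open>w\<close>, and Ax8 would put \<open>\<psi>\<close> into \<open>w\<close>.\<close>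
    show "\<alpha> \<in> w \<or> \<beta> \<in> w" if "\<alpha> \<^bold>\<or> \<beta> \<in> w" for \<alpha> \<beta>
      using that imp \<psi> axiom [OF Ax8 [of \<alpha> \<psi> \<beta>]] mp by blast
  qed
  then show thesis
    using that T \<psi> by blast
qed

lemma theorems_theory: "RmbC_theory Ax {\<chi>. provable Ax \<chi>}"
  by unfold_locales (auto intro: provable_MP)

lemma prime_separation:
  assumes "\<not> provable Ax (\<alpha> \<^bold>\<rightarrow> \<beta>)"
  obtains w where "prime_theory Ax w" and "\<alpha> \<in> w" and "\<beta> \<notin> w"
proof -
  interpret RmbC_theory Ax "{\<chi>. provable Ax \<chi>}"
    by (rule theorems_theory)
  show thesis
    using prime_extension [OF Imp_theory [of \<alpha>], of \<beta>] assms that Imp_refl [of \<alpha>] by blast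
qed

section \<open>The canonical frame\<close>

definition canon_worlds :: "schema set \<Rightarrow> fm set set" where
  "canon_worlds Ax = {w. prime_theory Ax w}"

definition ext :: "schema set \<Rightarrow> fm \<Rightarrow> fm set set" where
  "ext Ax \<alpha> = {w \<in> canon_worlds Ax. \<alpha> \<in> w}"

text \<open>\<open>inv\<close> picks an arbitrary formula defining \<open>X\<close>; the choice
  turns out to be immaterial. The default \<open>{}\<close> reduces negation to complement, and the
  default \<open>canon_worlds Ax\<close> makes a non-definable set consistent at every
  world.\<close>

definition canon :: "schema set \<Rightarrow> fm set frame" where
  "canon Ax = \<lparr>worlds = canon_worlds Ax,
     Sneg = (\<lambda>X. if X \<in> range (ext Ax) then ext Ax (\<^bold>\<not> (inv (ext Ax) X)) else {}),
     Scirc = (\<lambda>X. if X \<in> range (ext Ax) then ext Ax (\<^bold>\<circ> (inv (ext Ax) X)) else canon_worlds Ax)\<rparr>"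

lemma worlds_canon [simp]: "worlds (canon Ax) = canon_worlds Ax"
  by (simp add: canon_def)

lemma ext_Con: "ext Ax (\<alpha> \<^bold>\<and> \<beta>) = ext Ax \<alpha> \<inter> ext Ax \<beta>"
  and ext_Dis: "ext Ax (\<alpha> \<^bold>\<or> \<beta>) = ext Ax \<alpha> \<union> ext Ax \<beta>"
  and ext_Imp: "ext Ax (\<alpha> \<^bold>\<rightarrow> \<beta>) = (canon_worlds Ax - ext Ax \<alpha>) \<union> ext Ax \<beta>"
  and ext_Neg: "canon_worlds Ax - ext Ax \<alpha> \<subseteq> ext Ax (\<^bold>\<not> \<alpha>)"
  and ext_Circ: "ext Ax (\<^bold>\<circ> \<alpha>) \<inter> ext Ax \<alpha> \<inter> ext Ax (\<^bold>\<not> \<alpha>) = {}"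
  unfolding ext_def canon_worlds_def
  by (auto simp: prime_theory.Dis_iff prime_theory.Imp_iff prime_theory.Neg_intro
      RmbC_theory.Con_iff [OF prime_theory.axioms(1)] dest: prime_theory.Circ_explosion)

lemma ext_subset: "ext Ax \<alpha> \<subseteq> canon_worlds Ax"
  by (auto simp: ext_def)

lemma ext_provable: "provable Ax \<alpha> \<Longrightarrow> ext Ax \<alpha> = canon_worlds Ax"
  by (auto simp: ext_def canon_worlds_def dest: RmbC_theory.provable_mem [OF prime_theory.axioms(1)])

lemma provable_Imp_if_ext_subset:
  assumes "ext Ax \<alpha> \<subseteq> ext Ax \<beta>"
  shows "provable Ax (\<alpha> \<^bold>\<rightarrow> \<beta>)"
proof (rule ccontr)
  assume "\<not> provable Ax (\<alpha> \<^bold>\<rightarrow> \<beta>)"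
  then obtain w where "prime_theory Ax w" and "\<alpha> \<in> w" and "\<beta> \<notin> w"
    by (rule prime_separation)
  with assms show False
    by (auto simp: ext_def canon_worlds_def)
qed

lemma provable_Iff_if_ext_eq:
  assumes "ext Ax \<alpha> = ext Ax \<beta>"
  shows "provable Ax (\<alpha> \<^bold>\<leftrightarrow> \<beta>)"
  using assms provable_Imp_if_ext_subset provable_MP provable_axiom [OF Ax3]
  by (metis order_refl)

lemma ext_eq_if_provable_Iff: "provable Ax (\<alpha> \<^bold>\<leftrightarrow> \<beta>) \<Longrightarrow> ext Ax \<alpha> = ext Ax \<beta>"
  using ext_provable [of Ax "\<alpha> \<^bold>\<leftrightarrow> \<beta>"] ext_subset [of Ax \<alpha>] ext_subset [of Ax \<beta>]
  unfolding ext_Con ext_Imp by blast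

text \<open>The formula picked by \<open>inv\<close> has the same extension as
  \<open>\<alpha>\<close>, hence is provably equivalent to it, and \<open>R_neg\<close> and
  \<open>R_circ\<close> carry the equivalence through the connectives.\<close>

lemma Sneg_ext: "Sneg (canon Ax) (ext Ax \<alpha>) = ext Ax (\<^bold>\<not> \<alpha>)"
  and Scirc_ext: "Scirc (canon Ax) (ext Ax \<alpha>) = ext Ax (\<^bold>\<circ> \<alpha>)"
proof -
  have "provable Ax (inv (ext Ax) (ext Ax \<alpha>) \<^bold>\<leftrightarrow> \<alpha>)"
    by (simp add: provable_Iff_if_ext_eq f_inv_into_f)
  then have "ext Ax (\<^bold>\<not> (inv (ext Ax) (ext Ax \<alpha>))) = ext Ax (\<^bold>\<not> \<alpha>)"
    and "ext Ax (\<^bold>\<circ> (inv (ext Ax) (ext Ax \<alpha>))) = ext Ax (\<^bold>\<circ> \<alpha>)"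
    by - (rule ext_eq_if_provable_Iff, erule provable_R_neg provable_R_circ)+
  then show "Sneg (canon Ax) (ext Ax \<alpha>) = ext Ax (\<^bold>\<not> \<alpha>)"
    and "Scirc (canon Ax) (ext Ax \<alpha>) = ext Ax (\<^bold>\<circ> \<alpha>)"
    by (simp_all add: canon_def)
qed

lemma canon_undefinable:
  assumes "X \<notin> range (ext Ax)"
  shows "Sneg (canon Ax) X = {}" and "Scirc (canon Ax) X = canon_worlds Ax"
  using assms by (simp_all add: canon_def)

lemma is_frame_canon: "canon_worlds Ax \<noteq> {} \<Longrightarrow> is_frame (canon Ax)"
  using ext_subset by (auto simp: is_frame_def canon_def)

text \<open>By Ax10 the complement in the negation clause is absorbed, and by bc1 the intersection
  in the consistency clause cuts nothing off. The valuation is arbitrary so that the schemas can be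
  treated as well as the truth lemma.\<close>

lemma denot_canon_Neg: "denot (canon Ax) d \<alpha> = ext Ax \<beta> \<Longrightarrow> denot (canon Ax) d (\<^bold>\<not> \<alpha>) = ext Ax (\<^bold>\<not> \<beta>)"
  and denot_canon_Circ: "denot (canon Ax) d \<alpha> = ext Ax \<beta> \<Longrightarrow> denot (canon Ax) d (\<^bold>\<circ> \<alpha>) = ext Ax (\<^bold>\<circ> \<beta>)"
  using ext_Neg [of Ax \<beta>] ext_Circ [of Ax \<beta>] ext_subset [of Ax "\<^bold>\<circ> \<beta>"]
  by (auto simp: Sneg_ext Scirc_ext)

lemma denot_canon: "denot (canon Ax) (\<lambda>p. ext Ax (Var p)) \<phi> = ext Ax \<phi>"
proof (induction \<phi>)
  case (Neg \<phi>)
  then show ?case by (rule denot_canon_Neg)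
next
  case (Circ \<phi>)
  then show ?case by (rule denot_canon_Circ)
qed (simp_all add: ext_Con ext_Dis ext_Imp)

text \<open>An instance depends on \<open>\<alpha>\<close> only through its denotation, so under any
  valuation a definable \<open>\<alpha>\<close> can be traded for a formula \<open>\<beta>\<close>
  defining it; the instance at \<open>\<beta>\<close> is an axiom when
  \<open>s \<in> Ax\<close>.\<close>

lemma denot_canon_inst:
  assumes "denot (canon Ax) d \<alpha> = ext Ax \<beta>"
  shows "denot (canon Ax) d (inst s \<alpha>) = ext Ax (inst s \<beta>)"
proof -
  have neg: "denot (canon Ax) d (\<^bold>\<not> \<alpha>) = ext Ax (\<^bold>\<not> \<beta>)"
    and circ: "denot (canon Ax) d (\<^bold>\<circ> \<alpha>) = ext Ax (\<^bold>\<circ> \<beta>)"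
    using assms by (rule denot_canon_Neg, rule denot_canon_Circ)
  have con: "denot (canon Ax) d (\<alpha> \<^bold>\<and> \<^bold>\<not> \<alpha>) = ext Ax (\<beta> \<^bold>\<and> \<^bold>\<not> \<beta>)"
    using assms neg by (simp add: ext_Con)
  note facts = assms neg circ con denot_canon_Neg [OF neg] denot_canon_Neg [OF circ]
    denot_canon_Neg [OF con]
  show ?thesis
    by (cases s)
      (simp_all only: inst.simps facts ext_Dis ext_Imp denot.simps(3,4) worlds_canon)
qed

text \<open>Classical complement is expressible as implication of a bottom formula. Used in
  contrapositive form: complements of non-definable sets are non-definable.\<close>

lemma Compl_definable:
  assumes "X \<subseteq> canon_worlds Ax" and "canon_worlds Ax - X \<in> range (ext Ax)"
  shows "X \<in> range (ext Ax)"
proof -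
  obtain \<alpha> where "canon_worlds Ax - X = ext Ax \<alpha>"
    using assms(2) by blast
  \<comment> \<open>By bc1 no proper theory contains a consistent contradiction.\<close>
  moreover define falsum where "falsum = \<^bold>\<circ> Var 0 \<^bold>\<and> Var 0 \<^bold>\<and> \<^bold>\<not> Var 0"
  moreover have "ext Ax falsum = {}"
    using ext_Circ [of Ax "Var 0"] by (auto simp: falsum_def ext_Con)
  ultimately have "X = ext Ax (\<alpha> \<^bold>\<rightarrow> falsum)"
    using assms(1) by (auto simp: ext_Imp)
  then show ?thesis
    by blast
qed

lemma Sneg_worlds_if_Ci:
  assumes "Ci \<in> Ax"
  shows "Sneg (canon Ax) (canon_worlds Ax) = {}"
proof -
  define \<beta> where "\<beta> = \<^bold>\<circ> Var 0"
  have ci: "ext Ax (\<^bold>\<not> \<^bold>\<circ> \<alpha>) \<subseteq> ext Ax \<alpha> \<inter> ext Ax (\<^bold>\<not> \<alpha>)" for \<alpha>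
    using ext_provable [OF provable_inst [OF assms, of \<alpha>]] ext_subset [of Ax "\<^bold>\<not> \<^bold>\<circ> \<alpha>"]
    by (auto simp: ext_Imp ext_Con)
  have empty: "ext Ax (\<^bold>\<not> \<^bold>\<circ> \<beta>) = {}"
    using ci [of \<beta>] ci [of "Var 0"] ext_Circ [of Ax "Var 0"] unfolding \<beta>_def by blast
  then have "canon_worlds Ax = ext Ax (\<^bold>\<circ> \<beta>)"
    using ext_Neg [of Ax "\<^bold>\<circ> \<beta>"] ext_subset [of Ax "\<^bold>\<circ> \<beta>"] by auto
  then show ?thesis
    using empty Sneg_ext by metis
qed

lemma canon_in_NM:
  assumes "canon_worlds Ax \<noteq> {}"
  shows "canon Ax \<in> NM Ax"
proof -
  have "denot (canon Ax) d (inst s \<alpha>) = canon_worlds Ax"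
    if "s \<in> Ax" and d: "d \<in> UNIV \<rightarrow> Pow (worlds (canon Ax))" for s \<alpha> d
  proof (cases "denot (canon Ax) d \<alpha> \<in> range (ext Ax)")
    case True
    then obtain \<beta> where "denot (canon Ax) d \<alpha> = ext Ax \<beta>"
      by blast
    then show ?thesis
      using denot_canon_inst [of Ax d \<alpha> \<beta> s] ext_provable provable_inst \<open>s \<in> Ax\<close> by metis
  next
    case False
    define X where "X = denot (canon Ax) d \<alpha>"
    have sub: "X \<subseteq> canon_worlds Ax"
      using denot_subset [OF is_frame_canon [OF assms] d] by (simp add: X_def)
    have X: "X \<notin> range (ext Ax)" and CX: "canon_worlds Ax - X \<notin> range (ext Ax)"
      using False sub Compl_definable by (auto simp: X_def)
    show ?thesis
      using \<open>s \<in> Ax\<close> Sneg_worlds_if_Ci [of Ax] sub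
      by (cases s) (auto simp flip: X_def simp: canon_undefinable [OF X] canon_undefinable [OF CX])
  qed
  then show ?thesis
    using is_frame_canon [OF assms] by (simp add: NM_def valid_in_def)
qed

lemma completeness:
  assumes "NM_valid TYPE(fm set) Ax \<phi>"
  shows "provable Ax \<phi>"
proof (rule ccontr)
  assume "\<not> provable Ax \<phi>"
  then have "\<phi> \<notin> {\<chi>. provable Ax \<chi>}"
    by simp
  then obtain w where "prime_theory Ax w" and "{\<chi>. provable Ax \<chi>} \<subseteq> w" and "\<phi> \<notin> w"
    by (rule prime_extension [OF theorems_theory])
  then have w: "w \<in> canon_worlds Ax" "\<phi> \<notin> w"
    by (simp_all add: canon_worlds_def)
  \<comment> \<open>The world refuting \<open>\<phi>\<close> also witnesses that the canonical frame
    is non-empty.\<close>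
  then have "canon Ax \<in> NM Ax"
    by (intro canon_in_NM) blast
  then have "valid_in (canon Ax) \<phi>"
    using assms by (simp add: NM_valid_def)
  moreover have "(\<lambda>p. ext Ax (Var p)) \<in> UNIV \<rightarrow> Pow (worlds (canon Ax))"
    using ext_subset by auto
  ultimately have "ext Ax \<phi> = canon_worlds Ax"
    unfolding valid_in_def by (metis denot_canon worlds_canon)
  with w show False
    by (auto simp: ext_def)
qed

theorem theorem5p15:
  fixes Ax :: "schema set" and \<Gamma> :: "fm set" and \<phi> :: fm
  assumes "Ax \<noteq> {}"
  shows "(derivable Ax \<Gamma> \<phi> \<longleftrightarrow> NM_consequence TYPE(fm set) Ax \<Gamma> \<phi>) \<and>
         (derivable Ax \<Gamma> \<phi> \<longrightarrow> NM_consequence TYPE('w) Ax \<Gamma> \<phi>)"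
proof -
  \<comment> \<open>Both consequence relations reduce to theorems and finite conjunctions of
    premises in the same way, so agreement on single formulas suffices, without compactness.\<close>
  have eq: "NM_valid TYPE(fm set) Ax \<psi> \<longleftrightarrow> provable Ax \<psi>" for \<psi>
    by (rule iffI [OF completeness soundness])
  show ?thesis
    unfolding derivable_def NM_consequence_def eq
    using soundness [of Ax _ "TYPE('w)"] by blast
qed

end
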